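(* For every integer $n\geq 1$ and every word $w\in\{+,-\}^n$, we have $\#\mathcal{P}_w=\#\mathcal{S}_{i(w)}$.
   Context: A total cyclic order on a finite set $X$ is a set $Z$ of triples of distinct elements of $X$ such that: (cyclicity) $(x,y,z)\in Z\Rightarrow (y,z,x)\in Z$; (asymmetry) $(x,y,z)\in Z\Rightarrow (z,y,x)\notin Z$; (transitivity) $(x,y,z)\in Z$ and $(x,z,u)\in Z\Rightarrow (x,y,u)\in Z$; (totality) for any three distinct $x,y,z$, either $(x,y,z)\in Z$ or $(z,y,x)\in Z$. Write $[m]=\{1,\dots,m\}$. For $w=\epsilon_1\cdots\epsilon_{n}\in\{+,-\}^{n}$, $\mathcal{P}_w$ is the set of total cyclic orders $Z$ on $[n+2]$ such that for every $1\leq i\leq n$, $(i,i+1,i+2)\in Z$ if $\epsilon_i=+$ and $(i+2,i+1,i)\in Z$ if $\epsilon_i=-$. For a permutation $\sigma$ of $[m]$ ($m\geq 2$), its descent pattern is the word $\epsilon_1\cdots\epsilon_{m-1}$ with $\epsilon_i=+$ if $\sigma(i+1)>\sigma(i)$ and $\epsilon_i=-$ if $\sigma(i+1)<\sigma(i)$; for $v\in\{+,-\}^{m-1}$, $\mathcal{S}_v$ is the set of permutations of $[m]$ with descent pattern $v$. The involution $i$ on words flips the signs at even positions: $i(\epsilon_1\cdots\epsilon_n)=\epsilon'_1\cdots\epsilon'_n$ with $\epsilon'_j=\epsilon_j$ for $j$ odd and $\epsilon'_j=-\epsilon_j$ for $j$ even. *)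

theory Defs
  imports "HOL-Combinatorics.Permutations"
begin

datatype pm = Plus | Minus

primrec flip :: "pm \<Rightarrow> pm" where
  "flip Plus = Minus"
| "flip Minus = Plus"

text \<open>A word is a list of signs. Mathematical positions are numbered from 1, list positions
  from 0, so the letter at position \<open>j\<close> of \<open>w\<close> is \<open>w ! (j - 1)\<close>.\<close>

definition total_cyclic_order_on :: "'a set \<Rightarrow> ('a \<times> 'a \<times> 'a) set \<Rightarrow> bool" where
  "total_cyclic_order_on X Z \<longleftrightarrow>
     (\<forall>x y z. (x, y, z) \<in> Z \<longrightarrow> x \<in> X \<and> y \<in> X \<and> z \<in> X \<and> x \<noteq> y \<and> y \<noteq> z \<and> x \<noteq> z) \<and>
     (\<forall>x y z. (x, y, z) \<in> Z \<longrightarrow> (y, z, x) \<in> Z) \<and>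
     (\<forall>x y z. (x, y, z) \<in> Z \<longrightarrow> (z, y, x) \<notin> Z) \<and>
     (\<forall>x y z u. (x, y, z) \<in> Z \<and> (x, z, u) \<in> Z \<longrightarrow> (x, y, u) \<in> Z) \<and>
     (\<forall>x\<in>X. \<forall>y\<in>X. \<forall>z\<in>X. x \<noteq> y \<and> y \<noteq> z \<and> x \<noteq> z \<longrightarrow> (x, y, z) \<in> Z \<or> (z, y, x) \<in> Z)"

definition pattern_cyclic_orders :: "pm list \<Rightarrow> (nat \<times> nat \<times> nat) set set" where
  "pattern_cyclic_orders w =
     {Z. total_cyclic_order_on {1..length w + 2} Z \<and>
         (\<forall>i\<in>{1..length w}.
            (w ! (i - 1) = Plus \<longrightarrow> (i, i + 1, i + 2) \<in> Z) \<and>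
            (w ! (i - 1) = Minus \<longrightarrow> (i + 2, i + 1, i) \<in> Z))}"

definition descent_pattern :: "nat \<Rightarrow> (nat \<Rightarrow> nat) \<Rightarrow> pm list" where
  "descent_pattern m \<sigma> = map (\<lambda>i. if \<sigma> (i + 1) > \<sigma> i then Plus else Minus) [1..<m]"

text \<open>A word of length \<open>m - 1\<close> describes permutations of \<open>{1..m}\<close>. Elements of
  \<open>{\<sigma>. \<sigma> permutes {1..m}}\<close> are the identity outside \<open>{1..m}\<close>, so each permutation
  is counted once.\<close>

definition descent_class :: "pm list \<Rightarrow> (nat \<Rightarrow> nat) set" where
  "descent_class v =
     {\<sigma>. \<sigma> permutes {1..length v + 1} \<and> descent_pattern (length v + 1) \<sigma> = v}"

definition flip_even :: "pm list \<Rightarrow> pm list" where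
  "flip_even w =
     map (\<lambda>j. if odd j then w ! (j - 1) else flip (w ! (j - 1))) [1..<length w + 1]"

text \<open>Both families are finite, so \<^const>\<open>card\<close> is their actual number of elements.\<close>

lemma finite_pattern_cyclic_orders: "finite (pattern_cyclic_orders w)"
proof (rule finite_subset)
  let ?X = "{1..length w + 2}"
  show "pattern_cyclic_orders w \<subseteq> Pow (?X \<times> ?X \<times> ?X)"
  proof (intro subsetI PowI)
    fix Z p assume Z: "Z \<in> pattern_cyclic_orders w" and p: "p \<in> Z"
    obtain x y z where xyz: "p = (x, y, z)" by (cases p)
    have "total_cyclic_order_on ?X Z"
      using Z unfolding pattern_cyclic_orders_def by (rule CollectE) (rule conjunct1)
    then have "\<forall>x y z. (x, y, z) \<in> Z \<longrightarrow>
        x \<in> ?X \<and> y \<in> ?X \<and> z \<in> ?X \<and> x \<noteq> y \<and> y \<noteq> z \<and> x \<noteq> z"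
      unfolding total_cyclic_order_on_def by (rule conjunct1)
    with p xyz have "x \<in> ?X \<and> y \<in> ?X \<and> z \<in> ?X" by metis
    then show "p \<in> ?X \<times> ?X \<times> ?X" unfolding xyz by (intro SigmaI) (elim conjE, assumption)+
  qed
qed simp

lemma finite_descent_class: "finite (descent_class v)"
  using finite_permutations[of "{1..length v + 1}"] unfolding descent_class_def
  by (rule rev_finite_subset) auto

end

theory Submission
  imports Defs
begin

text \<open>Refine the count of cyclic orders on \<open>{1..n+2}\<close> by the number \<open>k\<close> of points on the arc from
  \<open>n+1\<close> to \<open>n+2\<close>. A cyclic order extends to the new point \<open>n+3\<close> in exactly one way with \<open>j\<close> points
  on the arc from \<open>n+2\<close> to \<open>n+3\<close>, and the new triple \<open>(n+1, n+2, n+3)\<close> is positive iff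
  \<open>k + j \<le> n\<close>. Permutations refined by their last value extend in the same way by appending a
  value \<open>l\<close>, which creates an ascent iff the previous last value is less than \<open>l\<close>. The condition
  \<open>j \<le> n - k\<close> reverses the order at every step, so the two recursions agree when the last value
  is read alternately from below and from above and the signs at even positions are flipped.\<close>

section \<open>Rules for total cyclic orders, and restriction to a subset\<close>

lemma total_cyclic_order_onD:
  assumes "total_cyclic_order_on X Z"
  shows tco_mem: "(x, y, z) \<in> Z \<Longrightarrow> x \<in> X \<and> y \<in> X \<and> z \<in> X \<and> x \<noteq> y \<and> y \<noteq> z \<and> x \<noteq> z"
    and tco_cycle: "(x, y, z) \<in> Z \<Longrightarrow> (y, z, x) \<in> Z"
    and tco_asym: "(x, y, z) \<in> Z \<Longrightarrow> (z, y, x) \<notin> Z"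
    and tco_trans: "(x, y, z) \<in> Z \<Longrightarrow> (x, z, u) \<in> Z \<Longrightarrow> (x, y, u) \<in> Z"
    and tco_total: "x \<in> X \<Longrightarrow> y \<in> X \<Longrightarrow> z \<in> X \<Longrightarrow> x \<noteq> y \<Longrightarrow> y \<noteq> z \<Longrightarrow> x \<noteq> z \<Longrightarrow>
      (x, y, z) \<in> Z \<or> (z, y, x) \<in> Z"
proof -
  note Z = assms[unfolded total_cyclic_order_on_def]
  note Z2 = Z[THEN conjunct2] and Z3 = Z[THEN conjunct2, THEN conjunct2]
  show "(x, y, z) \<in> Z \<Longrightarrow> x \<in> X \<and> y \<in> X \<and> z \<in> X \<and> x \<noteq> y \<and> y \<noteq> z \<and> x \<noteq> z"
    using Z[THEN conjunct1] by blast
  show "(x, y, z) \<in> Z \<Longrightarrow> (y, z, x) \<in> Z"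
    using Z2[THEN conjunct1] by blast
  show "(x, y, z) \<in> Z \<Longrightarrow> (z, y, x) \<notin> Z"
    using Z3[THEN conjunct1] by blast
  show "(x, y, z) \<in> Z \<Longrightarrow> (x, z, u) \<in> Z \<Longrightarrow> (x, y, u) \<in> Z"
    using Z3[THEN conjunct2, THEN conjunct1] by blast
  show "x \<in> X \<Longrightarrow> y \<in> X \<Longrightarrow> z \<in> X \<Longrightarrow> x \<noteq> y \<Longrightarrow> y \<noteq> z \<Longrightarrow> x \<noteq> z \<Longrightarrow>
      (x, y, z) \<in> Z \<or> (z, y, x) \<in> Z"
    using Z3[THEN conjunct2, THEN conjunct2] by blast
qed

lemma total_cyclic_order_onI:
  assumes 1: "\<And>x y z. (x, y, z) \<in> Z \<Longrightarrow> x \<in> X \<and> y \<in> X \<and> z \<in> X \<and> x \<noteq> y \<and> y \<noteq> z \<and> x \<noteq> z"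
    and 2: "\<And>x y z. (x, y, z) \<in> Z \<Longrightarrow> (y, z, x) \<in> Z"
    and 3: "\<And>x y z. (x, y, z) \<in> Z \<Longrightarrow> (z, y, x) \<notin> Z"
    and 4: "\<And>x y z u. (x, y, z) \<in> Z \<Longrightarrow> (x, z, u) \<in> Z \<Longrightarrow> (x, y, u) \<in> Z"
    and 5: "\<And>x y z. x \<in> X \<Longrightarrow> y \<in> X \<Longrightarrow> z \<in> X \<Longrightarrow> x \<noteq> y \<Longrightarrow> y \<noteq> z \<Longrightarrow> x \<noteq> z \<Longrightarrow>
      (x, y, z) \<in> Z \<or> (z, y, x) \<in> Z"
  shows "total_cyclic_order_on X Z"
proof -
  have "\<forall>x y z. (x, y, z) \<in> Z \<longrightarrow> x \<in> X \<and> y \<in> X \<and> z \<in> X \<and> x \<noteq> y \<and> y \<noteq> z \<and> x \<noteq> z"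
    using 1 by blast
  moreover have "\<forall>x y z. (x, y, z) \<in> Z \<longrightarrow> (y, z, x) \<in> Z" using 2 by blast
  moreover have "\<forall>x y z. (x, y, z) \<in> Z \<longrightarrow> (z, y, x) \<notin> Z" using 3 by blast
  moreover have "\<forall>x y z u. (x, y, z) \<in> Z \<and> (x, z, u) \<in> Z \<longrightarrow> (x, y, u) \<in> Z" using 4 by blast
  moreover have "\<forall>x\<in>X. \<forall>y\<in>X. \<forall>z\<in>X. x \<noteq> y \<and> y \<noteq> z \<and> x \<noteq> z \<longrightarrow> (x, y, z) \<in> Z \<or> (z, y, x) \<in> Z"
    using 5 by blast
  ultimately show ?thesis unfolding total_cyclic_order_on_def by (intro conjI)
qed

lemma tco_restrict:
  assumes Z: "total_cyclic_order_on X Z" and "Y \<subseteq> X"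
  shows "total_cyclic_order_on Y (Z \<inter> Y \<times> Y \<times> Y)"
proof -
  note D = total_cyclic_order_onD[OF Z]
  show ?thesis
  proof (rule total_cyclic_order_onI)
    fix x y z assume *: "(x, y, z) \<in> Z \<inter> Y \<times> Y \<times> Y"
    then show "x \<in> Y \<and> y \<in> Y \<and> z \<in> Y \<and> x \<noteq> y \<and> y \<noteq> z \<and> x \<noteq> z"
      using D(1)[of x y z] by simp
    show "(y, z, x) \<in> Z \<inter> Y \<times> Y \<times> Y" using * D(2)[of x y z] by simp
    show "(z, y, x) \<notin> Z \<inter> Y \<times> Y \<times> Y" using * D(3)[of x y z] by simp
    show "(x, y, u) \<in> Z \<inter> Y \<times> Y \<times> Y" if "(x, z, u) \<in> Z \<inter> Y \<times> Y \<times> Y" for u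
      using * that D(4)[of x y z u] by simp
  next
    fix x y z assume "x \<in> Y" "y \<in> Y" "z \<in> Y" "x \<noteq> y" "y \<noteq> z" "x \<noteq> z"
    then show "(x, y, z) \<in> Z \<inter> Y \<times> Y \<times> Y \<or> (z, y, x) \<in> Z \<inter> Y \<times> Y \<times> Y"
      using D(5)[of x y z] \<open>Y \<subseteq> X\<close> by auto
  qed
qed

section \<open>Cutting the circle open at a point\<close>

text \<open>The strict linear order read around the circle starting at \<open>p\<close>. Triples in
  \<open>Z\<close> have distinct entries, so \<open>p\<close> has to be put in as least element by a
  separate disjunct.\<close>

definition cut_at :: "'a \<Rightarrow> ('a \<times> 'a \<times> 'a) set \<Rightarrow> 'a set \<Rightarrow> 'a \<Rightarrow> 'a \<Rightarrow> bool" where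
  "cut_at p Z X x y \<longleftrightarrow> x \<in> X \<and> y \<in> X \<and> (x = p \<and> y \<noteq> p \<or> (p, x, y) \<in> Z)"

lemma cut_at_linear:
  assumes "total_cyclic_order_on X Z" "p \<in> X"
  shows cut_at_irrefl: "\<not> cut_at p Z X x x"
    and cut_at_trans: "cut_at p Z X x y \<Longrightarrow> cut_at p Z X y z \<Longrightarrow> cut_at p Z X x z"
    and cut_at_total: "x \<in> X \<Longrightarrow> y \<in> X \<Longrightarrow> x \<noteq> y \<Longrightarrow> cut_at p Z X x y \<or> cut_at p Z X y x"
proof -
  note D = total_cyclic_order_onD[OF assms(1)]
  show "\<not> cut_at p Z X x x"
    using D(1) unfolding cut_at_def by blast
  show "cut_at p Z X x y \<Longrightarrow> cut_at p Z X y z \<Longrightarrow> cut_at p Z X x z"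
    using D(1) D(4) unfolding cut_at_def by metis
  show "x \<in> X \<Longrightarrow> y \<in> X \<Longrightarrow> x \<noteq> y \<Longrightarrow> cut_at p Z X x y \<or> cut_at p Z X y x"
    using D(2) D(5) assms(2) unfolding cut_at_def by metis
qed

text \<open>For \<open>x\<close> different from \<open>p\<close>, the hypotheses rotate to
  \<open>(y, z, p)\<close> and \<open>(y, p, x)\<close>, and transitivity based at \<open>y\<close>
  gives \<open>(y, z, x)\<close>.\<close>

lemma cut_at_chain:
  assumes "total_cyclic_order_on X Z" "cut_at p Z X x y" "cut_at p Z X y z"
  shows "(x, y, z) \<in> Z"
proof -
  note D = total_cyclic_order_onD[OF assms(1)]
  from assms(2,3) D(1) have yz: "(p, y, z) \<in> Z" and xy: "x = p \<or> (p, x, y) \<in> Z"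
    unfolding cut_at_def by blast+
  from xy show ?thesis
  proof
    assume "(p, x, y) \<in> Z"
    then have "(y, p, x) \<in> Z" by (rule D(2)[OF D(2)])
    with D(2)[OF yz] have "(y, z, x) \<in> Z" by (rule D(4))
    then show ?thesis by (rule D(2)[OF D(2)])
  qed (use yz in simp)
qed

lemma cut_at_cyclic_chain:
  assumes Z: "total_cyclic_order_on X Z"
    and "cut_at p Z X x y \<and> cut_at p Z X y z \<or> cut_at p Z X y z \<and> cut_at p Z X z x \<or>
      cut_at p Z X z x \<and> cut_at p Z X x y"
  shows "(x, y, z) \<in> Z"
proof -
  note chain = cut_at_chain[OF Z] and rot = tco_cycle[OF Z]
  from assms(2) show ?thesis
    by (elim disjE conjE) (rule chain rot[OF rot[OF chain]] rot[OF chain]; assumption)+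
qed

text \<open>A cyclic order can be recovered from its cut at a single point. For the forward
  direction, if no rotation of the triple is ascending, then linearity of the cut makes a rotation
  of the reversed triple ascending, against asymmetry.\<close>

lemma tco_iff_cut_at:
  assumes "total_cyclic_order_on X Z" "p \<in> X" "x \<in> X" "y \<in> X" "z \<in> X"
  shows "(x, y, z) \<in> Z \<longleftrightarrow>
    cut_at p Z X x y \<and> cut_at p Z X y z \<or> cut_at p Z X y z \<and> cut_at p Z X z x \<or>
    cut_at p Z X z x \<and> cut_at p Z X x y" (is "_ \<longleftrightarrow> ?R")
proof
  note D = total_cyclic_order_onD[OF assms(1)]
  note chain = cut_at_cyclic_chain[OF assms(1)]
  show "(x, y, z) \<in> Z" if ?R
    using that by (rule chain)
  show ?R if Z: "(x, y, z) \<in> Z"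
  proof (rule ccontr)
    assume "\<not> ?R"
    moreover have "x \<noteq> y" "y \<noteq> z" "x \<noteq> z" using D(1)[OF Z] by auto
    ultimately have "cut_at p Z X z y \<and> cut_at p Z X y x \<or> cut_at p Z X y x \<and> cut_at p Z X x z \<or>
      cut_at p Z X x z \<and> cut_at p Z X z y"
      using cut_at_total[OF assms(1,2), of x y] cut_at_total[OF assms(1,2), of y z]
        cut_at_total[OF assms(1,2), of x z] assms(3-5) by argo
    then have "(z, y, x) \<in> Z" by (rule chain)
    then show False using D(3)[OF Z] by blast
  qed
qed

text \<open>The pullback along \<open>f\<close> of the cyclic order obtained by closing up the line
  of natural numbers.\<close>

definition cyclic_order_of :: "'a set \<Rightarrow> ('a \<Rightarrow> nat) \<Rightarrow> ('a \<times> 'a \<times> 'a) set" where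
  "cyclic_order_of X f = {(x, y, z). x \<in> X \<and> y \<in> X \<and> z \<in> X \<and>
     (f x < f y \<and> f y < f z \<or> f y < f z \<and> f z < f x \<or> f z < f x \<and> f x < f y)}"

lemma tco_cyclic_order_of:
  assumes "inj_on f X"
  shows "total_cyclic_order_on X (cyclic_order_of X f)"
proof -
  have "f x \<noteq> f y" if "x \<in> X" "y \<in> X" "x \<noteq> y" for x y
    using assms that by (auto dest: inj_onD)
  then have "(x, y, z) \<in> cyclic_order_of X f \<or> (z, y, x) \<in> cyclic_order_of X f"
    if "x \<in> X" "y \<in> X" "z \<in> X" "x \<noteq> y" "y \<noteq> z" "x \<noteq> z" for x y z
    using that unfolding cyclic_order_of_def by (simp add: neq_iff) (metis less_trans)
  then show ?thesis
    by (intro total_cyclic_order_onI) (auto simp: cyclic_order_of_def)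
qed

text \<open>A normal form into which new points are easily inserted: each point is numbered by its
  rank in the linear order cut at \<open>p\<close>.\<close>

lemma tco_obtain_rank:
  assumes Z: "total_cyclic_order_on X Z" and "finite X" "p \<in> X"
  obtains f where "bij_betw f X {..<card X}" "f p = 0" "Z = cyclic_order_of X f"
proof
  note D = total_cyclic_order_onD[OF Z]
  note L = cut_at_linear[OF Z \<open>p \<in> X\<close>]
  define f where "f x = card {y. cut_at p Z X y x}" for x
  have below: "{y. cut_at p Z X y x} \<subseteq> X - {x}" for x
    using L(1) by (auto simp: cut_at_def)
  then have fin: "finite {y. cut_at p Z X y x}" for x
    using \<open>finite X\<close> by (meson finite_Diff finite_subset)
  have mono: "f x < f y" if "cut_at p Z X x y" for x y
    unfolding f_def using that L by (intro psubset_card_mono fin) blast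
  have iff: "f x < f y \<longleftrightarrow> cut_at p Z X x y" if "x \<in> X" "y \<in> X" for x y
    using mono L(3)[OF that] by (metis less_asym less_irrefl)
  have inj: "inj_on f X"
    by (rule inj_onI) (metis L(3) mono less_irrefl)
  have "f x < card X" if "x \<in> X" for x
  proof -
    have "f x \<le> card (X - {x})"
      unfolding f_def using below \<open>finite X\<close> by (intro card_mono) auto
    also have "\<dots> < card X"
      using that \<open>finite X\<close> by (rule card_Diff1_less[rotated])
    finally show ?thesis .
  qed
  then have "f ` X \<subseteq> {..<card X}" by auto
  then have "f ` X = {..<card X}"
    using inj by (intro card_subset_eq) (simp_all add: card_image)
  with inj show "bij_betw f X {..<card X}"
    by (simp add: bij_betw_def)
  have "{y. cut_at p Z X y p} = {}"
    using D(1) by (auto simp: cut_at_def)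
  then show "f p = 0" by (simp add: f_def)
  show "Z = cyclic_order_of X f"
  proof -
    have "(x, y, z) \<in> Z \<longleftrightarrow> (x, y, z) \<in> cyclic_order_of X f" for x y z
    proof (cases "x \<in> X \<and> y \<in> X \<and> z \<in> X")
      case True
      then show ?thesis
        using tco_iff_cut_at[OF Z \<open>p \<in> X\<close>, of x y z] by (simp add: cyclic_order_of_def iff)
    next
      case False
      then show ?thesis using D(1)[of x y z] by (auto simp: cyclic_order_of_def)
    qed
    then show ?thesis by auto
  qed
qed

section \<open>Extending a cyclic order by one point\<close>

text \<open>Seen from \<open>p\<close>, the arc from \<open>p\<close> to \<open>q\<close> is an
  initial segment of the remaining points of \<open>X\<close>. Initial segments of one linear order
  are nested, so equal size makes them equal; then both orders have the same cut at
  \<open>p\<close>.\<close>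

lemma tco_extension_unique:
  assumes Z1: "total_cyclic_order_on (insert q X) Z1" and Z2: "total_cyclic_order_on (insert q X) Z2"
    and "finite X" "p \<in> X" "q \<notin> X"
    and restr: "Z1 \<inter> X \<times> X \<times> X = Z2 \<inter> X \<times> X \<times> X"
    and card: "card {x. (p, x, q) \<in> Z1} = card {x. (p, x, q) \<in> Z2}"
  shows "Z1 = Z2"
proof -
  let ?A1 = "{x. (p, x, q) \<in> Z1}" and ?A2 = "{x. (p, x, q) \<in> Z2}"
  note D1 = total_cyclic_order_onD[OF Z1] and D2 = total_cyclic_order_onD[OF Z2]
  have p: "p \<in> insert q X" "p \<noteq> q" using assms by auto
  have old: "(x, y, z) \<in> Z1 \<longleftrightarrow> (x, y, z) \<in> Z2" if "x \<in> X" "y \<in> X" "z \<in> X" for x y z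
    using restr that by blast
  have A_sub: "?A1 \<subseteq> X" "?A2 \<subseteq> X" using D1(1) D2(1) by blast+
  have fin: "finite ?A1" "finite ?A2"
    using A_sub \<open>finite X\<close> by (auto intro: finite_subset)
  \<comment> \<open>Seen from \<open>p\<close>, points on the arc precede all points off it; this is
    the initial segment property.\<close>
  have chain1: "(p, x, y) \<in> Z1" if "x \<in> ?A1" "y \<in> X - ?A1" "y \<noteq> p" for x y
    using that D1(2,4,5) p by (metis DiffD1 DiffD2 insertCI mem_Collect_eq \<open>q \<notin> X\<close>)
  have chain2: "(p, x, y) \<in> Z2" if "x \<in> ?A2" "y \<in> X - ?A2" "y \<noteq> p" for x y
    using that D2(2,4,5) p by (metis DiffD1 DiffD2 insertCI mem_Collect_eq \<open>q \<notin> X\<close>)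
  have "?A1 \<subseteq> ?A2 \<or> ?A2 \<subseteq> ?A1"
  proof (rule ccontr)
    assume "\<not> ?thesis"
    then obtain x y where xy: "x \<in> ?A1" "x \<notin> ?A2" "y \<in> ?A2" "y \<notin> ?A1" by blast
    moreover have "x \<in> X" "y \<in> X" "x \<noteq> p" "y \<noteq> p"
      using xy A_sub D1(1) D2(1) by blast+
    ultimately have "(p, x, y) \<in> Z1" "(p, y, x) \<in> Z1"
      using chain1 chain2 old[OF \<open>p \<in> X\<close>] by (auto simp del: mem_Collect_eq)
    then show False using D1(2,3) by metis
  qed
  then have A: "(p, x, q) \<in> Z1 \<longleftrightarrow> (p, x, q) \<in> Z2" for x
    using card card_subset_eq fin by (metis mem_Collect_eq)
  \<comment> \<open>Beyond \<open>q\<close> lie the points other than \<open>p\<close> and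
    \<open>q\<close> that are not on the arc, by totality and asymmetry.\<close>
  have A': "(p, q, x) \<in> Z1 \<longleftrightarrow> (p, q, x) \<in> Z2" for x
    using A D1 D2 p by (metis insertCI)
  have "cut_at p Z1 (insert q X) x y \<longleftrightarrow> cut_at p Z2 (insert q X) x y" for x y
    using A A' old[OF \<open>p \<in> X\<close>] D1(1) D2(1) unfolding cut_at_def by blast
  then have new: "(x, y, z) \<in> Z1 \<longleftrightarrow> (x, y, z) \<in> Z2"
    if "x \<in> insert q X" "y \<in> insert q X" "z \<in> insert q X" for x y z
    unfolding tco_iff_cut_at[OF Z1 p(1) that] tco_iff_cut_at[OF Z2 p(1) that] by (simp only:)
  have "(x, y, z) \<in> Z1 \<longleftrightarrow> (x, y, z) \<in> Z2" for x y z
  proof (cases "x \<in> insert q X \<and> y \<in> insert q X \<and> z \<in> insert q X")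
    case True
    then show ?thesis by (intro new) simp_all
  next
    case False
    then show ?thesis using D1(1)[of x y z] D2(1)[of x y z] by argo
  qed
  then show ?thesis by auto
qed

lemma tco_extension_exists:
  assumes Z: "total_cyclic_order_on X Z" and "finite X" "p \<in> X" "q \<notin> X" "j < card X"
  obtains Z' where "total_cyclic_order_on (insert q X) Z'" "card {x. (p, x, q) \<in> Z'} = j"
    "Z' \<inter> X \<times> X \<times> X = Z"
proof -
  obtain f where f: "bij_betw f X {..<card X}" "f p = 0" "Z = cyclic_order_of X f"
    using tco_obtain_rank[OF Z] assms by blast
  \<comment> \<open>Doubling the ranks frees the odd numbers. Since \<open>p\<close> has rank 0, the
    value \<open>2 * j + 1\<close> leaves exactly the points of rank 1 to \<open>j\<close> between
    \<open>p\<close> and \<open>q\<close>.\<close>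
  define g where "g x = (if x = q then 2 * j + 1 else 2 * f x)" for x
  let ?Z' = "cyclic_order_of (insert q X) g"
  have "g q \<noteq> g x" if "x \<in> X" for x
    using that \<open>q \<notin> X\<close> unfolding g_def by presburger
  moreover have "inj_on g X"
    using f(1) \<open>q \<notin> X\<close> by (auto simp: g_def inj_on_def bij_betw_def)
  ultimately have "inj_on g (insert q X)" by auto
  moreover have "card {x. (p, x, q) \<in> ?Z'} = j"
  proof -
    have "{x. (p, x, q) \<in> ?Z'} = {x \<in> X. f x \<in> {1..j}}"
      using assms f(2) by (auto simp: cyclic_order_of_def g_def)
    moreover have "f ` {x \<in> X. f x \<in> {1..j}} = {1..j}"
    proof -
      have "f ` {x \<in> X. f x \<in> {1..j}} = f ` X \<inter> {1..j}" by blast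
      also have "\<dots> = {1..j}"
        using f(1) \<open>j < card X\<close> by (auto simp: bij_betw_def)
      finally show ?thesis .
    qed
    moreover have "inj_on f {x \<in> X. f x \<in> {1..j}}"
      using f(1) by (auto simp: bij_betw_def inj_on_def)
    ultimately show ?thesis by (metis card_image card_atLeastAtMost diff_Suc_1)
  qed
  moreover have "?Z' \<inter> X \<times> X \<times> X = Z"
  proof -
    have "g x = 2 * f x" if "x \<in> X" for x
      using that \<open>q \<notin> X\<close> by (auto simp: g_def)
    then have "(x, y, z) \<in> ?Z' \<inter> X \<times> X \<times> X \<longleftrightarrow> (x, y, z) \<in> Z" for x y z
      unfolding f(3) cyclic_order_of_def by (cases "x \<in> X \<and> y \<in> X \<and> z \<in> X") auto
    then show ?thesis by auto
  qed
  ultimately show ?thesis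
    using that tco_cyclic_order_of by blast
qed

section \<open>Arc sizes and the orientation of a triple\<close>

text \<open>The two open arcs between \<open>r\<close> and \<open>p\<close> partition the other
  points; the summand 2 counts \<open>r\<close> and \<open>p\<close> themselves.\<close>

lemma arc_complement:
  assumes Z: "total_cyclic_order_on X Z" and "finite X" "r \<in> X" "p \<in> X" "r \<noteq> p"
  shows "card {x. (r, x, p) \<in> Z} + card {x. (p, x, r) \<in> Z} + 2 = card X"
proof -
  note D = total_cyclic_order_onD[OF Z]
  let ?A = "{x. (r, x, p) \<in> Z}" and ?B = "{x. (p, x, r) \<in> Z}"
  have X: "X = insert r (insert p (?A \<union> ?B))"
    using assms(3-5) D(1) D(5)[of r _ p] by blast
  then have fin: "finite ?A" "finite ?B" using \<open>finite X\<close> by (metis finite_Un finite_insert)+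
  have "?A \<inter> ?B = {}" "r \<notin> ?A \<union> ?B" "p \<notin> ?A \<union> ?B"
    using D(1,3) by blast+
  with fin \<open>r \<noteq> p\<close> have "card (insert r (insert p (?A \<union> ?B))) = card ?A + card ?B + 2"
    by (simp add: card_Un_disjoint)
  with X show ?thesis by simp
qed

text \<open>The arcs from \<open>p\<close> to \<open>q\<close> and from \<open>p\<close> to
  \<open>r\<close> both start at \<open>p\<close>, so their sizes tell which of \<open>q\<close> and
  \<open>r\<close> comes first after \<open>p\<close>. The size of the second arc is then traded for
  that of its complementary arc from \<open>r\<close> to \<open>p\<close>.\<close>

lemma triple_iff_arc_card:
  assumes Z: "total_cyclic_order_on (insert q X) Z" and "finite X" "r \<in> X" "p \<in> X" "r \<noteq> p" "q \<notin> X"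
  shows "(r, p, q) \<in> Z \<longleftrightarrow>
    card {x. (r, x, p) \<in> Z \<inter> X \<times> X \<times> X} + card {x. (p, x, q) \<in> Z} + 2 \<le> card X"
proof -
  note D = total_cyclic_order_onD[OF Z]
  let ?A = "{x. (p, x, q) \<in> Z}" and ?B = "{x. (p, x, r) \<in> Z \<inter> X \<times> X \<times> X}"
  have sum: "card {x. (r, x, p) \<in> Z \<inter> X \<times> X \<times> X} + card ?B + 2 = card X"
    using arc_complement[OF tco_restrict[OF Z], of X r p] assms by blast
  have fin: "finite ?A" "finite ?B"
    using \<open>finite X\<close> by (auto intro: finite_subset[of _ "insert q X"] dest: D(1))
  have "card ?A \<le> card ?B" if t: "(r, p, q) \<in> Z"
  proof (rule card_mono[OF fin(2)], rule subsetI)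
    fix x assume "x \<in> ?A"
    then have x: "(p, x, q) \<in> Z" by simp
    moreover have "(p, q, r) \<in> Z" using D(2)[OF t] .
    ultimately have "(p, x, r) \<in> Z" by (rule D(4))
    then show "x \<in> ?B" using D(1)[OF x] assms by blast
  qed
  moreover have "card ?B < card ?A" if t: "(r, p, q) \<notin> Z"
  proof (rule psubset_card_mono[OF fin(1)])
    have "(q, p, r) \<in> Z" using that D(5)[of r p q] assms by blast
    then have r: "(p, r, q) \<in> Z" by (rule D(2))
    \<comment> \<open>The inclusion is strict because \<open>r\<close> lies on the arc from
      \<open>p\<close> to \<open>q\<close>.\<close>
    then show "?B \<subset> ?A" using D(1,4) by blast
  qed
  ultimately show ?thesis using sum by linarith
qed

section \<open>The recursion for pattern cyclic orders\<close>

text \<open>For a word of length \<open>n\<close>, the points \<open>n + 1\<close> and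
  \<open>n + 2\<close> are the last two of the ground set.\<close>

definition last_arc :: "nat \<Rightarrow> (nat \<times> nat \<times> nat) set \<Rightarrow> nat" where
  "last_arc n Z = card {x. (n + 1, x, n + 2) \<in> Z}"

lemma ball_atLeastAtMost_Suc: "(\<forall>i\<in>{1..Suc n}. P i) \<longleftrightarrow> (\<forall>i\<in>{1..n}. P i) \<and> P (Suc n)"
  by (subst atLeastAtMostSuc_conv) auto

text \<open>The last letter only orients \<open>(n + 1, n + 2, n + 3)\<close>, which
  \<open>triple_iff_arc_card\<close> expresses by arc sizes; as \<open>X\<close> has
  \<open>n + 2\<close> points, the summand 2 there cancels.\<close>

lemma pattern_cyclic_orders_snoc:
  fixes w e
  defines "X \<equiv> {1..length w + 2}" and "n \<equiv> length w"
  shows "Z \<in> pattern_cyclic_orders (w @ [e]) \<longleftrightarrow>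
    total_cyclic_order_on (insert (n + 3) X) Z \<and> Z \<inter> X \<times> X \<times> X \<in> pattern_cyclic_orders w \<and>
    (e = Plus \<longleftrightarrow> last_arc n (Z \<inter> X \<times> X \<times> X) + last_arc (n + 1) Z \<le> n)"
proof -
  have ins: "{1..length (w @ [e]) + 2} = insert (n + 3) X"
    by (auto simp: X_def n_def)
  have t: "(n + 1, n + 2, n + 3) \<in> Z \<longleftrightarrow> last_arc n (Z \<inter> X \<times> X \<times> X) + last_arc (n + 1) Z \<le> n"
    if "total_cyclic_order_on (insert (n + 3) X) Z"
    using triple_iff_arc_card[OF that, of "n + 1" "n + 2"]
    by (simp add: last_arc_def X_def n_def numeral_3_eq_3)
  \<comment> \<open>Exactly one orientation of the new triple holds, so the two implications merge
    into one equivalence.\<close>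
  have last: "(e = Plus \<longrightarrow> (n + 1, n + 2, n + 3) \<in> Z) \<and> (e = Minus \<longrightarrow> (n + 3, n + 2, n + 1) \<in> Z) \<longleftrightarrow>
      (e = Plus \<longleftrightarrow> (n + 1, n + 2, n + 3) \<in> Z)"
    if Z: "total_cyclic_order_on (insert (n + 3) X) Z"
  proof -
    have "n + 1 \<in> X" "n + 2 \<in> X" by (auto simp: X_def n_def)
    then have "(n + 1, n + 2, n + 3) \<notin> Z \<longleftrightarrow> (n + 3, n + 2, n + 1) \<in> Z"
      using tco_total[OF Z, of "n + 1" "n + 2" "n + 3"] tco_asym[OF Z] by auto
    then show ?thesis by (cases e) auto
  qed
  \<comment> \<open>The earlier letters concern triples inside \<open>X\<close>, so restricting
    \<open>Z\<close> to \<open>X\<close> does not affect them.\<close>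
  have letters: "(\<forall>i\<in>{1..length (w @ [e])}.
       ((w @ [e]) ! (i - 1) = Plus \<longrightarrow> (i, i + 1, i + 2) \<in> Z) \<and>
       ((w @ [e]) ! (i - 1) = Minus \<longrightarrow> (i + 2, i + 1, i) \<in> Z)) \<longleftrightarrow>
    (\<forall>i\<in>{1..length w}.
       (w ! (i - 1) = Plus \<longrightarrow> (i, i + 1, i + 2) \<in> Z \<inter> X \<times> X \<times> X) \<and>
       (w ! (i - 1) = Minus \<longrightarrow> (i + 2, i + 1, i) \<in> Z \<inter> X \<times> X \<times> X)) \<and>
    (e = Plus \<longrightarrow> (n + 1, n + 2, n + 3) \<in> Z) \<and> (e = Minus \<longrightarrow> (n + 3, n + 2, n + 1) \<in> Z)"
    unfolding length_append_singleton ball_atLeastAtMost_Suc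
    by (intro arg_cong2[where f = conj] ball_cong)
      (auto simp: X_def n_def nth_append numeral_3_eq_3)
  have restr: "total_cyclic_order_on X (Z \<inter> X \<times> X \<times> X)"
    if "total_cyclic_order_on (insert (n + 3) X) Z"
    using that by (rule tco_restrict) auto
  show ?thesis
  proof (cases "total_cyclic_order_on (insert (n + 3) X) Z")
    case True
    show ?thesis
      unfolding pattern_cyclic_orders_def mem_Collect_eq ins X_def[symmetric] letters
        last[OF True] unfolding t[OF True]
      by (simp only: True restr[OF True] simp_thms)
  next
    case False
    then show ?thesis unfolding pattern_cyclic_orders_def ins by blast
  qed
qed

text \<open>Restriction to \<open>X\<close> is a bijection, by uniqueness and existence of the
  extension with prescribed arc size \<open>j\<close>. The bound on \<open>j\<close> says
  \<open>j < card X\<close>: there is one place for the new point per old point.\<close>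

lemma card_pattern_cyclic_orders_snoc:
  fixes w e
  defines "n \<equiv> length w"
  assumes "j \<le> n + 1"
  shows "card {Z \<in> pattern_cyclic_orders (w @ [e]). last_arc (n + 1) Z = j} =
    card {Z \<in> pattern_cyclic_orders w. e = Plus \<longleftrightarrow> last_arc n Z + j \<le> n}" (is "card ?S = card ?T")
proof -
  define X where "X = {1..length w + 2}"
  have X: "finite X" "n + 2 \<in> X" "n + 3 \<notin> X" "j < card X"
    using assms by (auto simp: X_def n_def)
  have arc: "last_arc (n + 1) Z = card {x. (n + 2, x, n + 3) \<in> Z}" for Z
    by (simp add: last_arc_def numeral_3_eq_3)
  note snoc = pattern_cyclic_orders_snoc[of _ w e, folded X_def n_def]
  have "bij_betw (\<lambda>Z. Z \<inter> X \<times> X \<times> X) ?S ?T"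
  proof (rule bij_betw_imageI, rule inj_onI)
    fix Z1 Z2 assume S: "Z1 \<in> ?S" "Z2 \<in> ?S"
      and restr: "Z1 \<inter> X \<times> X \<times> X = Z2 \<inter> X \<times> X \<times> X"
    show "Z1 = Z2"
    proof (rule tco_extension_unique[OF _ _ X(1-3) restr])
      show "total_cyclic_order_on (insert (n + 3) X) Z1" "total_cyclic_order_on (insert (n + 3) X) Z2"
        using S by (simp_all add: snoc)
      show "card {x. (n + 2, x, n + 3) \<in> Z1} = card {x. (n + 2, x, n + 3) \<in> Z2}"
        using S unfolding arc[symmetric] by simp
    qed
  next
    have "Z \<inter> X \<times> X \<times> X \<in> ?T" if "Z \<in> ?S" for Z
      using that by (auto simp: snoc)
    moreover have "Z \<in> (\<lambda>Z. Z \<inter> X \<times> X \<times> X) ` ?S" if T: "Z \<in> ?T" for Z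
    proof -
      from T have "total_cyclic_order_on X Z"
        by (simp add: pattern_cyclic_orders_def X_def)
      then obtain Z' where "total_cyclic_order_on (insert (n + 3) X) Z'"
        "last_arc (n + 1) Z' = j" "Z' \<inter> X \<times> X \<times> X = Z"
        using tco_extension_exists X unfolding arc by metis
      with T have "Z' \<in> ?S" "Z = Z' \<inter> X \<times> X \<times> X" by (auto simp: snoc)
      then show ?thesis by blast
    qed
    ultimately show "(\<lambda>Z. Z \<inter> X \<times> X \<times> X) ` ?S = ?T"
      by (intro equalityI subsetI) blast+
  qed
  then show ?thesis by (rule bij_betw_same_card)
qed

lemma last_arc_le:
  assumes "Z \<in> pattern_cyclic_orders w"
  shows "last_arc (length w) Z \<le> length w"
proof -
  have Z: "total_cyclic_order_on {1..length w + 2} Z"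
    using assms by (simp add: pattern_cyclic_orders_def)
  have "card {x. (length w + 1, x, length w + 2) \<in> Z} + 2 \<le> length w + 2"
    using arc_complement[OF Z, of "length w + 1" "length w + 2"] by simp
  then show ?thesis by (simp add: last_arc_def)
qed

section \<open>Appending a last value to a permutation\<close>

text \<open>The increasing map of the naturals whose image omits exactly \<open>l\<close>, making
  room for a new value there.\<close>

definition raise_from :: "nat \<Rightarrow> nat \<Rightarrow> nat" where
  "raise_from l x = (if l \<le> x then x + 1 else x)"

text \<open>The final branch keeps the function the identity outside \<open>{1..m + 1}\<close>, as
  \<open>permutes\<close> requires.\<close>

definition append_value :: "nat \<Rightarrow> nat \<Rightarrow> (nat \<Rightarrow> nat) \<Rightarrow> nat \<Rightarrow> nat" where
  "append_value m l \<sigma> i = (if i \<in> {1..m} then raise_from l (\<sigma> i) else if i = m + 1 then l else i)"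

text \<open>Deletion of the last value followed by standardisation; \<open>l\<close> is meant to be
  that last value.\<close>

definition drop_value :: "nat \<Rightarrow> nat \<Rightarrow> (nat \<Rightarrow> nat) \<Rightarrow> nat \<Rightarrow> nat" where
  "drop_value m l \<sigma> i = (if i \<in> {1..m} then if l < \<sigma> i then \<sigma> i - 1 else \<sigma> i else i)"

lemma permutes_atLeastAtMostI:
  assumes "\<And>i. i \<in> {1..m} \<Longrightarrow> \<sigma> i \<in> {1..m}" "inj_on \<sigma> {1..m}" "\<And>i. i \<notin> {1..m} \<Longrightarrow> \<sigma> i = i"
  shows "\<sigma> permutes {1..m::nat}"
proof (rule bij_imp_permutes)
  have "\<sigma> ` {1..m} = {1..m}"
    using assms(1,2) by (intro card_subset_eq) (auto simp: card_image)
  then show "bij_betw \<sigma> {1..m} {1..m}" using assms(2) by (simp add: bij_betw_def)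
qed (use assms(3) in blast)

lemma append_value_permutes:
  assumes \<sigma>: "\<sigma> permutes {1..m}" and l: "l \<in> {1..m + 1}"
  shows "append_value m l \<sigma> permutes {1..m + 1}"
proof (rule permutes_atLeastAtMostI)
  have mem: "\<sigma> i \<in> {1..m}" if "i \<in> {1..m}" for i
    using that permutes_in_image[OF \<sigma>] by blast
  show "append_value m l \<sigma> i \<in> {1..m + 1}" if "i \<in> {1..m + 1}" for i
    using that mem[of i] l by (auto simp: append_value_def raise_from_def)
  show "inj_on (append_value m l \<sigma>) {1..m + 1}"
  proof (rule inj_onI)
    fix i j assume "i \<in> {1..m + 1}" "j \<in> {1..m + 1}" "append_value m l \<sigma> i = append_value m l \<sigma> j"
    then have "i = j \<or> \<sigma> i = \<sigma> j"
      by (auto simp: append_value_def raise_from_def split: if_splits)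
    then show "i = j" using permutes_inj[OF \<sigma>] by (auto dest: injD)
  qed
qed (auto simp: append_value_def)

lemma drop_value_permutes:
  assumes \<sigma>: "\<sigma> permutes {1..m + 1}" and l: "\<sigma> (m + 1) = l"
  shows "drop_value m l \<sigma> permutes {1..m}"
proof (rule permutes_atLeastAtMostI)
  have mem: "\<sigma> i \<in> {1..m + 1}" if "i \<in> {1..m + 1}" for i
    using that permutes_in_image[OF \<sigma>] by blast
  have l': "l \<in> {1..m + 1}" using mem[of "m + 1"] l by simp
  have neq: "\<sigma> i \<noteq> l" if "i \<in> {1..m}" for i
    using that l inj_eq[OF permutes_inj[OF \<sigma>], of i "m + 1"] by auto
  show "drop_value m l \<sigma> i \<in> {1..m}" if i: "i \<in> {1..m}" for i
    using i mem[of i] neq[OF i] l' by (auto simp: drop_value_def)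
  show "inj_on (drop_value m l \<sigma>) {1..m}"
  proof (rule inj_onI)
    fix i j assume "i \<in> {1..m}" "j \<in> {1..m}" "drop_value m l \<sigma> i = drop_value m l \<sigma> j"
    then have "\<sigma> i = \<sigma> j"
      using neq[of i] neq[of j] by (auto simp: drop_value_def split: if_splits)
    then show "i = j" by (simp add: inj_eq[OF permutes_inj[OF \<sigma>]])
  qed
qed (auto simp: drop_value_def)

lemma descent_pattern_Suc:
  assumes "m \<ge> 1"
  shows "descent_pattern (m + 1) \<sigma> = descent_pattern m \<sigma> @ [if \<sigma> (m + 1) > \<sigma> m then Plus else Minus]"
  using assms by (simp add: descent_pattern_def)

text \<open>\<open>raise_from l\<close> is strictly increasing, so comparisons among the first
  \<open>m\<close> values survive.\<close>

lemma descent_pattern_append_value: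
  "descent_pattern m (append_value m l \<sigma>) = descent_pattern m \<sigma>"
  unfolding descent_pattern_def
  by (rule map_cong) (auto simp: append_value_def raise_from_def)

lemma append_drop_value:
  assumes \<sigma>: "\<sigma> permutes {1..m + 1}" and l: "\<sigma> (m + 1) = l"
  shows "append_value m l (drop_value m l \<sigma>) = \<sigma>"
proof
  fix i
  have "\<sigma> i \<noteq> l" if "i \<in> {1..m}"
    using that l inj_eq[OF permutes_inj[OF \<sigma>], of i "m + 1"] by auto
  moreover have "\<sigma> i = i" if "i \<notin> {1..m + 1}"
    using that \<sigma> by (simp add: permutes_def)
  ultimately show "append_value m l (drop_value m l \<sigma>) i = \<sigma> i"
    using l by (auto simp: append_value_def drop_value_def raise_from_def)
qed

lemma drop_append_value:
  assumes "\<sigma> permutes {1..m}"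
  shows "drop_value m l (append_value m l \<sigma>) = \<sigma>"
  using permutes_not_in[OF assms]
  by (auto simp: append_value_def drop_value_def raise_from_def fun_eq_iff)

text \<open>Appending \<open>l\<close> is inverse to dropping the last value. The word gains one
  letter, an ascent exactly when \<open>\<sigma> m < l\<close>.\<close>

lemma card_descent_class_snoc:
  fixes v d
  defines "m \<equiv> length v + 1"
  assumes l: "l \<in> {1..m + 1}"
  shows "card {\<sigma> \<in> descent_class (v @ [d]). \<sigma> (m + 1) = l} =
    card {\<sigma> \<in> descent_class v. d = Plus \<longleftrightarrow> \<sigma> m < l}" (is "card ?S = card ?T")
proof -
  have app: "append_value m l \<sigma> \<in> ?S \<longleftrightarrow> \<sigma> \<in> ?T" if "\<sigma> permutes {1..m}" for \<sigma>
  proof -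
    \<comment> \<open>Raising does not change whether a value is below \<open>l\<close>, and a value
      equal to \<open>l\<close> moves above it.\<close>
    have "(if append_value m l \<sigma> (m + 1) > append_value m l \<sigma> m then Plus else Minus) = d \<longleftrightarrow>
        (d = Plus \<longleftrightarrow> \<sigma> m < l)"
      by (cases d) (auto simp: append_value_def raise_from_def m_def)
    moreover have "append_value m l \<sigma> (m + 1) = l"
      by (simp add: append_value_def)
    ultimately show ?thesis
      using that append_value_permutes[OF that l] descent_pattern_Suc[of m "append_value m l \<sigma>"]
      by (auto simp: descent_class_def descent_pattern_append_value m_def)
  qed
  have S: "\<sigma> permutes {1..m + 1}" "\<sigma> (m + 1) = l" if "\<sigma> \<in> ?S" for \<sigma>
    using that by (auto simp: descent_class_def m_def)
  have T: "\<sigma> permutes {1..m}" if "\<sigma> \<in> ?T" for \<sigma>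
    using that by (auto simp: descent_class_def m_def)
  have "bij_betw (append_value m l) ?T ?S"
  proof (rule bij_betw_byWitness[where f' = "drop_value m l"])
    show "\<forall>\<sigma>\<in>?T. drop_value m l (append_value m l \<sigma>) = \<sigma>"
      using T drop_append_value by blast
    show "\<forall>\<sigma>\<in>?S. append_value m l (drop_value m l \<sigma>) = \<sigma>"
      using S append_drop_value by blast
    show "append_value m l ` ?T \<subseteq> ?S"
      using T app by blast
    show "drop_value m l ` ?S \<subseteq> ?T"
      using S app drop_value_permutes append_drop_value by (metis (no_types, lifting) image_subsetI)
  qed
  then show ?thesis by (rule bij_betw_same_card[symmetric])
qed

section \<open>Matching the two recursions\<close>

lemma length_flip_even [simp]: "length (flip_even w) = length w"
  unfolding flip_even_def length_map length_upt by simp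

text \<open>The new letter has position \<open>length w + 1\<close>, so it is flipped when
  \<open>length w\<close> is odd.\<close>

lemma flip_even_snoc:
  "flip_even (w @ [e]) = flip_even w @ [if even (length w) then e else flip e]"
  unfolding flip_even_def by (auto simp: nth_append)

text \<open>Equidistributed statistics satisfy any predicate equally often: sum over the attained
  values that satisfy \<open>P\<close>.\<close>

lemma card_filter_eq_of_fibres:
  assumes "finite S" "finite T" and eq: "\<And>k. card {x \<in> S. a x = k} = card {y \<in> T. b y = k}"
  shows "card {x \<in> S. P (a x)} = card {y \<in> T. P (b y)}"
proof -
  let ?K = "{k \<in> a ` S \<union> b ` T. P k}"
  have "card {x \<in> S. P (a x)} = (\<Sum>k\<in>?K. card {x \<in> S. a x = k})"
    using assms(1,2)
    by (subst card_UN_disjoint[symmetric]) (auto intro!: arg_cong[where f = card])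
  also have "\<dots> = (\<Sum>k\<in>?K. card {y \<in> T. b y = k})"
    by (simp add: eq)
  also have "\<dots> = card {y \<in> T. P (b y)}"
    using assms(1,2)
    by (subst card_UN_disjoint[symmetric]) (auto intro!: arg_cong[where f = card])
  finally show ?thesis .
qed

text \<open>The statistic on permutations that is equidistributed with \<open>last_arc\<close>.\<close>

definition last_rank :: "nat \<Rightarrow> (nat \<Rightarrow> nat) \<Rightarrow> nat" where
  "last_rank n \<sigma> = (if even n then \<sigma> (n + 1) - 1 else n + 1 - \<sigma> (n + 1))"

lemma last_in_range:
  assumes "\<sigma> \<in> descent_class v"
  shows "\<sigma> (length v + 1) \<in> {1..length v + 1}"
proof -
  have "\<sigma> permutes {1..length v + 1}"
    using assms by (simp add: descent_class_def)
  from permutes_in_image[OF this] show ?thesis by simp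
qed

text \<open>The same recursion as for cyclic orders. For even \<open>n\<close> the condition
  \<open>last_rank n \<sigma> + j \<le> n\<close> is an ascent to the new value; for odd
  \<open>n\<close> it is a descent, which the flipped sign compensates.\<close>

lemma card_descent_class_flip_even_snoc:
  fixes w e
  defines "n \<equiv> length w"
  assumes j: "j \<le> n + 1"
  shows "card {\<sigma> \<in> descent_class (flip_even (w @ [e])). last_rank (n + 1) \<sigma> = j} =
    card {\<sigma> \<in> descent_class (flip_even w). e = Plus \<longleftrightarrow> last_rank n \<sigma> + j \<le> n}"
proof -
  \<comment> \<open>The last value with \<open>last_rank (n + 1)\<close> equal to \<open>j\<close>;
    the parity of \<open>n + 1\<close> decides the direction of reading.\<close>
  define l where "l = (if even n then n + 2 - j else j + 1)"
  define d where "d = (if even n then e else flip e)"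
  have word: "flip_even (w @ [e]) = flip_even w @ [d]"
    by (simp add: flip_even_snoc d_def n_def)
  have l: "l \<in> {1..length (flip_even w) + 1 + 1}"
    using j by (auto simp: l_def n_def)
  have "last_rank (n + 1) \<sigma> = j \<longleftrightarrow> \<sigma> (n + 2) = l"
    if "\<sigma> \<in> descent_class (flip_even w @ [d])" for \<sigma>
    using last_in_range[OF that] j by (auto simp: last_rank_def l_def n_def)
  then have "{\<sigma> \<in> descent_class (flip_even (w @ [e])). last_rank (n + 1) \<sigma> = j} =
      {\<sigma> \<in> descent_class (flip_even w @ [d]). \<sigma> (length (flip_even w) + 1 + 1) = l}"
    unfolding word by (auto simp: n_def)
  moreover have "(d = Plus \<longleftrightarrow> \<sigma> (n + 1) < l) \<longleftrightarrow> (e = Plus \<longleftrightarrow> last_rank n \<sigma> + j \<le> n)"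
    if "\<sigma> \<in> descent_class (flip_even w)" for \<sigma>
    using last_in_range[OF that] j
    by (cases e) (auto simp: last_rank_def l_def d_def n_def)
  then have "{\<sigma> \<in> descent_class (flip_even w). d = Plus \<longleftrightarrow> \<sigma> (length (flip_even w) + 1) < l} =
      {\<sigma> \<in> descent_class (flip_even w). e = Plus \<longleftrightarrow> last_rank n \<sigma> + j \<le> n}"
    by (auto simp: n_def)
  ultimately show ?thesis
    using card_descent_class_snoc[OF l, of d] by simp
qed

lemma last_rank_le:
  assumes "\<sigma> \<in> descent_class v"
  shows "last_rank (length v) \<sigma> \<le> length v"
  using last_in_range[OF assms] by (auto simp: last_rank_def)

text \<open>Two points admit no triple of distinct elements.\<close>

lemma pattern_cyclic_orders_Nil: "pattern_cyclic_orders [] = {{}}"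
proof -
  have "Z = {}" if "total_cyclic_order_on {1..2} Z" for Z :: "(nat \<times> nat \<times> nat) set"
    using tco_mem[OF that] by fastforce
  moreover have "total_cyclic_order_on {1..2} ({} :: (nat \<times> nat \<times> nat) set)"
    by (rule total_cyclic_order_onI) auto
  ultimately have "total_cyclic_order_on {1..2} Z \<longleftrightarrow> Z = {}" for Z :: "(nat \<times> nat \<times> nat) set"
    by blast
  then show ?thesis
    by (simp add: pattern_cyclic_orders_def numeral_2_eq_2)
qed

lemma descent_class_Nil: "descent_class [] = {id}"
  by (auto simp: descent_class_def descent_pattern_def)

text \<open>The refinement of the theorem that induction on the word can carry: both recursions
  count the objects for the shorter word by the same condition on their statistics.\<close>

lemma card_fibres_eq:
  "card {Z \<in> pattern_cyclic_orders w. last_arc (length w) Z = k} =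
   card {\<sigma> \<in> descent_class (flip_even w). last_rank (length w) \<sigma> = k}"
proof (induction w arbitrary: k rule: rev_induct)
  case Nil
  have "flip_even [] = []" by (simp add: flip_even_def)
  \<comment> \<open>Each side has a single object, with statistic 0.\<close>
  then show ?case
    by (cases "k = 0") (simp_all add: pattern_cyclic_orders_Nil descent_class_Nil last_arc_def
        last_rank_def cong: conj_cong)
next
  case (snoc e w)
  let ?n = "length w"
  show ?case
  proof (cases "k \<le> ?n + 1")
    case True
    have "card {Z \<in> pattern_cyclic_orders w. e = Plus \<longleftrightarrow> last_arc ?n Z + k \<le> ?n} =
        card {\<sigma> \<in> descent_class (flip_even w). e = Plus \<longleftrightarrow> last_rank ?n \<sigma> + k \<le> ?n}"
      using finite_pattern_cyclic_orders finite_descent_class snoc.IH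
      by (rule card_filter_eq_of_fibres)
    with True show ?thesis
      using card_pattern_cyclic_orders_snoc[of k w e] card_descent_class_flip_even_snoc[of k w e]
      by simp
  next
    case False
    \<comment> \<open>Neither statistic exceeds the length of the word, so both fibres are
      empty.\<close>
    then have "{Z \<in> pattern_cyclic_orders (w @ [e]). last_arc (length (w @ [e])) Z = k} = {}"
      "{\<sigma> \<in> descent_class (flip_even (w @ [e])). last_rank (length (w @ [e])) \<sigma> = k} = {}"
      using last_arc_le[of _ "w @ [e]"] last_rank_le[of _ "flip_even (w @ [e])"] by auto
    then show ?thesis by (simp only: card.empty)
  qed
qed

text \<open>The constantly true predicate sums the refined equality over all values of the
  statistics.\<close>

theorem theorem1:
  fixes n :: nat and w :: "pm list"
  assumes "n \<ge> 1" and "length w = n"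
  shows "card (pattern_cyclic_orders w) = card (descent_class (flip_even w))"
  using card_filter_eq_of_fibres[OF finite_pattern_cyclic_orders finite_descent_class card_fibres_eq,
      where P = "\<lambda>_. True"]
  by simp

end
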